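(* Suppose $\Gamma^v=\partial\Omega$ and that the body force is conservative, i.e. there is a scalar potential $\psi$ with $\rho\mathbf{b}=-\mathrm{grad}[\psi]$ in $\Omega$. Let $\mathbf{v}:\Omega\to\mathbb{R}^{nd}$ be the Darcy–Brinkman velocity, i.e. there is a pressure field $p:\Omega\to\mathbb{R}$ such that, with $\mathbf{D}=\frac12(\mathrm{grad}[\mathbf{v}]+\mathrm{grad}[\mathbf{v}]^{\mathrm T})$, $$\alpha\mathbf{v}+\mathrm{grad}[p]-\mathrm{div}[2\mu\mathbf{D}]=\rho\mathbf{b}\ \text{ in }\Omega,\qquad \mathrm{div}[\mathbf{v}]=0\ \text{ in }\Omega,\qquad \mathbf{v}=\mathbf{v}^{\mathrm p}\ \text{ on }\partial\Omega .$$ Then every kinematically admissible vector field $\widetilde{\mathbf{v}}:\Omega\to\mathbb{R}^{nd}$ (i.e. $\mathrm{div}[\widetilde{\mathbf{v}}]=0$ in $\Omega$ and $\widetilde{\mathbf{v}}=\mathbf{v}^{\mathrm p}$ on $\partial\Omega$) satisfies $$\Phi[\mathbf{v}]\le\Phi[\widetilde{\mathbf{v}}],\qquad\text{where}\quad \Phi[\mathbf{z}]:=\int_\Omega\alpha\,\mathbf{z}\cdot\mathbf{z}\,\mathrm{d}\Omega+\int_\Omega 2\mu\,\mathbf{D}[\mathbf{z}]\cdot\mathbf{D}[\mathbf{z}]\,\mathrm{d}\Omega$$ and $\mathbf{D}[\mathbf{z}]=\frac12(\mathrm{grad}[\mathbf{z}]+\mathrm{grad}[\mathbf{z}]^{\mathrm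 T})$.
   Context: $\Omega\subset\mathbb{R}^{nd}$ is a bounded open domain ($nd$ is the number of spatial dimensions) with piecewise smooth boundary $\partial\Omega=\overline\Omega\setminus\Omega$; $\Gamma^v$ is the part of the boundary on which velocity is prescribed (here all of it). The given data are: the drag coefficient $\alpha:\Omega\to\mathbb{R}$ with $\alpha(\mathbf{x})>0$, the viscosity $\mu>0$, the fluid density $\rho$, the specific body force $\mathbf{b}:\Omega\to\mathbb{R}^{nd}$, and the prescribed velocity $\mathbf{v}^{\mathrm p}$ on $\partial\Omega$. For second-order tensors $\mathbf{A}\cdot\mathbf{B}=\sum_{i,j}A_{ij}B_{ij}$; $\mathrm{div}$ of a tensor field is taken row-wise. All data and fields (including $\mathbf{v}$, $p$, $\psi$, $\widetilde{\mathbf{v}}$) are assumed sufficiently smooth up to the boundary that the equations hold pointwise, the integrals are finite and the divergence theorem (integration by parts) applies. *)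

theory Defs
  imports "HOL-Analysis.Analysis"
begin

definition partial :: "'n \<Rightarrow> (real^'n \<Rightarrow> 'b::real_normed_vector) \<Rightarrow> real^'n \<Rightarrow> 'b"
  where "partial i f x = frechet_derivative f (at x) (axis i 1)"

text \<open>
  The space of functions that are \<open>k\<close> times continuously differentiable up to the boundary:
  the function is continuous on the closure of \<open>\<Omega>\<close>, and all its partial derivatives up to
  order \<open>k\<close>, which are only taken at points of \<open>\<Omega>\<close>, extend continuously to the closure.
\<close>

primrec Ck_closure :: "nat \<Rightarrow> (real^'n) set \<Rightarrow> (real^'n \<Rightarrow> 'b::real_normed_vector) \<Rightarrow> bool" where
  "Ck_closure 0 \<Omega> f \<longleftrightarrow> continuous_on (closure \<Omega>) f"
| "Ck_closure (Suc k) \<Omega> f \<longleftrightarrow>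
     continuous_on (closure \<Omega>) f \<and> (\<forall>x\<in>\<Omega>. f differentiable (at x)) \<and>
     (\<forall>i. \<exists>g. Ck_closure k \<Omega> g \<and> (\<forall>x\<in>\<Omega>. g x = partial i f x))"

definition grad :: "(real^'n \<Rightarrow> real) \<Rightarrow> real^'n \<Rightarrow> real^'n"
  where "grad f x = (\<chi> i. partial i f x)"

text \<open>
  The gradient of a vector field is the library's \<^const>\<open>jacobian\<close>, whose entry in row \<open>i\<close> and
  column \<open>j\<close> is the \<open>j\<close>-th partial derivative of the \<open>i\<close>-th component.
\<close>

definition vdiv :: "(real^'n \<Rightarrow> real^'n) \<Rightarrow> real^'n \<Rightarrow> real"
  where "vdiv v x = trace (jacobian v (at x))"

definition tdiv :: "(real^'n \<Rightarrow> real^'n^'n) \<Rightarrow> real^'n \<Rightarrow> real^'n"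
  where "tdiv T x = (\<chi> i. vdiv (\<lambda>y. row i (T y)) x)"

definition sym_grad :: "(real^'n \<Rightarrow> real^'n) \<Rightarrow> real^'n \<Rightarrow> real^'n^'n"
  where "sym_grad v x = (1/2) *\<^sub>R (jacobian v (at x) + transpose (jacobian v (at x)))"

text \<open>
  A set has piecewise smooth boundary if, apart from a closed set \<open>N\<close> of edges and corners
  whose \<open>(n-1)\<close>-dimensional Hausdorff measure is zero, the boundary is locally a regular level
  set of a continuously differentiable function. As \<open>N\<close> is compact when the set is bounded,
  the condition on its measure can be expressed by finite covers with balls.
\<close>

definition smooth_boundary_point :: "(real^'n) set \<Rightarrow> real^'n \<Rightarrow> bool" where
  "smooth_boundary_point \<Omega> x \<longleftrightarrow>
     (\<exists>U g G. open U \<and> x \<in> U \<and> continuous_on U G \<and>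
        (\<forall>y\<in>U. (GDERIV g y :> G y) \<and> G y \<noteq> 0) \<and>
        U \<inter> frontier \<Omega> = {y\<in>U. g y = 0})"

definition null_hypersurface_measure :: "(real^'n) set \<Rightarrow> bool" where
  "null_hypersurface_measure N \<longleftrightarrow>
     (\<forall>e>0. \<exists>C :: ((real^'n) \<times> real) set. finite C \<and> (\<forall>(c, r)\<in>C. 0 < r) \<and>
        N \<subseteq> (\<Union>(c, r)\<in>C. ball c r) \<and> (\<Sum>(c, r)\<in>C. r ^ (CARD('n) - 1)) < e)"

definition piecewise_smooth_boundary :: "(real^'n) set \<Rightarrow> bool" where
  "piecewise_smooth_boundary \<Omega> \<longleftrightarrow>
     (\<exists>N. closed N \<and> N \<subseteq> frontier \<Omega> \<and> null_hypersurface_measure N \<and>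
        (\<forall>x \<in> frontier \<Omega> - N. smooth_boundary_point \<Omega> x))"

definition kinematically_admissible ::
    "(real^'n) set \<Rightarrow> (real^'n \<Rightarrow> real^'n) \<Rightarrow> (real^'n \<Rightarrow> real^'n) \<Rightarrow> bool" where
  "kinematically_admissible \<Omega> vp w \<longleftrightarrow>
     (\<forall>x\<in>\<Omega>. vdiv w x = 0) \<and> (\<forall>x\<in>frontier \<Omega>. w x = vp x)"

definition darcy_brinkman_velocity ::
    "(real^'n) set \<Rightarrow> (real^'n \<Rightarrow> real) \<Rightarrow> real \<Rightarrow> real \<Rightarrow> (real^'n \<Rightarrow> real^'n) \<Rightarrow>
     (real^'n \<Rightarrow> real^'n) \<Rightarrow> (real^'n \<Rightarrow> real^'n) \<Rightarrow> bool" where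
  "darcy_brinkman_velocity \<Omega> \<alpha> \<mu> \<rho> b vp v \<longleftrightarrow>
     (\<exists>p :: real^'n \<Rightarrow> real. Ck_closure 1 \<Omega> p \<and>
        (\<forall>x\<in>\<Omega>. \<alpha> x *\<^sub>R v x + grad p x - tdiv (\<lambda>y. (2 * \<mu>) *\<^sub>R sym_grad v y) x = \<rho> *\<^sub>R b x) \<and>
        (\<forall>x\<in>\<Omega>. vdiv v x = 0) \<and>
        (\<forall>x\<in>frontier \<Omega>. v x = vp x))"

text \<open>The inner product of matrices is the sum of the products of their entries.\<close>

definition dissipation ::
    "(real^'n) set \<Rightarrow> (real^'n \<Rightarrow> real) \<Rightarrow> real \<Rightarrow> (real^'n \<Rightarrow> real^'n) \<Rightarrow> real" where
  "dissipation \<Omega> \<alpha> \<mu> z =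
     (LINT x:\<Omega>|lborel. \<alpha> x * (z x \<bullet> z x)) +
     (LINT x:\<Omega>|lborel. 2 * \<mu> * (sym_grad z x \<bullet> sym_grad z x))"

end

theory Submission
  imports Defs
begin

text \<open>
  Put \<open>w = vt - v\<close>, which is divergence-free and vanishes on the boundary. Testing the momentum
  equation with \<open>w\<close> eliminates the pressure and the potential and shows that \<open>v\<close> and \<open>w\<close> are
  orthogonal for the bilinear form of the dissipation, so the dissipation of \<open>vt = v + w\<close> is that
  of \<open>v\<close> plus that of \<open>w\<close>.

  The only case of the divergence theorem this needs is \<open>\<integral> \<partial>\<^sub>i f = 0\<close> for \<open>f\<close> vanishing on
  the boundary, which holds for every bounded open set: each line parallel to the \<open>i\<close>-th axis meets
  it in countably many disjoint open intervals with end points on the boundary, and on each of them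
  the fundamental theorem of calculus gives \<open>0\<close>.
\<close>

section \<open>Derivatives on bounded open subsets of the line\<close>

text \<open>A component of \<open>U\<close> is a bounded open interval with both end points in
  \<open>frontier U\<close>, where \<open>f\<close> vanishes, so the fundamental theorem of calculus
  gives \<open>0\<close>. Integrability of \<open>f'\<close> turns this gauge integral into a
  Lebesgue integral.\<close>

lemma integral_derivative_eq_0_on_component:
  fixes f f' :: "real \<Rightarrow> real"
  assumes U: "open U" "bounded U" and C: "C \<in> components U"
    and cont: "continuous_on (closure U) f" and zero: "\<And>t. t \<in> frontier U \<Longrightarrow> f t = 0"
    and deriv: "\<And>t. t \<in> U \<Longrightarrow> (f has_real_derivative f' t) (at t)"
    and int: "set_integrable lborel U f'"
  shows "(LINT t:C|lborel. f' t) = 0"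
proof -
  have CU: "C \<subseteq> U" and ne: "C \<noteq> {}" and con: "connected C"
    using C by (auto simp: in_components_subset in_components_nonempty in_components_connected)
  have oC: "open C" using U(1) C by (rule open_components)
  have "connected (closure C)" "compact (closure C)"
    using con U(2) CU by (auto simp: connected_imp_connected_closure bounded_subset)
  then obtain a b where ab: "closure C = {a..b}"
    using connected_compact_interval_1 by metis
  have "convex C" using con by (simp add: is_interval_connected_1[symmetric] is_interval_convex_1[symmetric])
  \<comment> \<open>An open convex set is the interior of its closure.\<close>
  then have C_eq: "C = {a<..<b}"
    using convex_interior_closure[of C] oC ab by (simp add: interior_open)
  have less: "a < b" using ne C_eq by simp
  have "frontier C = {a, b}"
    using ab oC C_eq less by (auto simp: frontier_def interior_open)
  then have "f a = 0" "f b = 0"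
    using frontier_of_components_subset[OF C] zero by auto
  \<comment> \<open>This form of the theorem asks for the derivative on the open interval and for
    continuity on the closed one, matching \<open>deriv\<close> and \<open>cont\<close>.\<close>
  moreover have "(f' has_integral (f b - f a)) {a..b}"
  proof (rule fundamental_theorem_of_calculus_interior)
    have "{a..b} \<subseteq> closure U" using closure_mono[OF CU] ab by simp
    then show "continuous_on {a..b} f" using cont continuous_on_subset by blast
  qed (use less deriv CU C_eq in \<open>auto simp: has_real_derivative_iff_has_vector_derivative\<close>)
  ultimately have "(f' has_integral 0) {a<..<b}"
    using has_integral_open_interval[of f' 0 a b] by simp
  moreover have "set_integrable lborel C f'"
    using set_integrable_subset[OF int] oC CU by simp
  ultimately show ?thesis
    using set_borel_integral_eq_integral(2) C_eq by (metis integral_unique)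
qed

text \<open>Countable additivity over the components, of which there may be infinitely many;
  integrability of \<open>f'\<close> on all of \<open>U\<close> justifies the summation.\<close>

lemma integral_derivative_eq_0:
  fixes f f' :: "real \<Rightarrow> real"
  assumes U: "open U" "bounded U"
    and cont: "continuous_on (closure U) f" and zero: "\<And>t. t \<in> frontier U \<Longrightarrow> f t = 0"
    and deriv: "\<And>t. t \<in> U \<Longrightarrow> (f has_real_derivative f' t) (at t)"
    and int: "set_integrable lborel U f'"
  shows "(LINT t:U|lborel. f' t) = 0"
proof -
  have cnt: "countable (components U)"
    using pairwise_disjoint_components[of U] open_components[OF U(1)]
    by (intro countable_disjoint_open_subsets) (auto simp: pairwise_def disjnt_def)
  \<comment> \<open>\<open>A n\<close> is the component with number \<open>n\<close>, or empty if no
    component has that number; this arranges the components as a sequence even when they are finite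
    in number.\<close>
  define A where "A n = \<Union>{C \<in> components U. to_nat_on (components U) C = n}" for n
  have A_cases: "A n = {} \<or> A n \<in> components U" for n
  proof (cases "\<exists>C \<in> components U. to_nat_on (components U) C = n")
    case True
    then obtain C where "C \<in> components U" "to_nat_on (components U) C = n" by blast
    moreover from this have "{D \<in> components U. to_nat_on (components U) D = n} = {C}"
      using inj_on_to_nat_on[OF cnt] by (auto dest: inj_onD)
    ultimately show ?thesis by (simp add: A_def)
  qed (auto simp: A_def)
  have A_int: "(LINT t:A n|lborel. f' t) = 0" for n
    using A_cases[of n] integral_derivative_eq_0_on_component[OF U _ cont zero deriv int]
    by (auto simp: set_lebesgue_integral_def)
  have UA: "U = (\<Union>n. A n)"
    unfolding A_def by (subst Union_components[of U, symmetric]) blast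
  have "(LINT t:(\<Union>n. A n)|lborel. f' t) = (\<Sum>n. LINT t:A n|lborel. f' t)"
  proof (rule lebesgue_integral_countable_add)
    show "A n \<in> sets lborel" for n
      using A_cases[of n] open_components[OF U(1)] by auto
    show "A i \<inter> A j = {}" if "i \<noteq> j" for i j
      using that components_nonoverlap by (fastforce simp: A_def)
    show "set_integrable lborel (\<Union>n. A n) f'"
      using int UA by simp
  qed
  then show ?thesis using A_int UA by simp
qed

section \<open>From integrals along parallel lines to integrals over the space\<close>

lemma lborel_integrable_shift:
  fixes g :: "'a::euclidean_space \<Rightarrow> 'b::{banach, second_countable_topology}"
  assumes "integrable lborel g"
  shows "integrable lborel (\<lambda>x. g (x + c))"
  using assms integrable_distr_eq[of "(+) c" lborel borel g] lborel_distr_plus[of c]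
  by (simp add: add.commute borel_measurable_integrable)

lemma lborel_integral_shift:
  fixes g :: "'a::euclidean_space \<Rightarrow> 'b::{banach, second_countable_topology}"
  assumes "g \<in> borel_measurable borel"
  shows "(LINT x|lborel. g (x + c)) = (LINT x|lborel. g x)"
  using assms by (subst (2) lborel_distr_plus[of c, symmetric])
    (simp add: integral_distr add.commute)

text \<open>Fubini is applied on the product of the whole space with the line, not to a splitting of
  the space along \<open>e\<close>, so that translation invariance takes the place of a change of
  coordinates.\<close>

lemma integral_eq_0_if_line_integrals_eq_0:
  fixes g :: "'a::euclidean_space \<Rightarrow> real"
  assumes int: "integrable lborel g" and e: "norm e = 1"
    and line: "\<And>x. (LINT t|lborel. g (x + t *\<^sub>R e)) = 0"
  shows "(LINT x|lborel. g x) = 0"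
proof -
  have [measurable]: "g \<in> borel_measurable borel" using int by auto
  have ee: "e \<bullet> e = 1" using e by (simp add: norm_eq_1)
  \<comment> \<open>The window \<open>0 \<le> x \<bullet> e \<le> 1\<close> makes \<open>(x, t) \<mapsto> g (x + t e)\<close> integrable; integrating over \<open>x\<close>
    first, the window sweeps over \<open>y = x + t e\<close> with total weight \<open>1\<close> and recovers the integral of \<open>g\<close>.\<close>
  define F where "F y t = indicator {0..1} (y \<bullet> e - t) * g y" for y t
  have F_meas[measurable]: "case_prod F \<in> borel_measurable (borel \<Otimes>\<^sub>M borel)"
    unfolding F_def by measurable
  have shifted: "(\<lambda>t. indicator {0..1} (c - t) :: real) = indicator {c - 1..c}" for c :: real
    by (auto simp: indicator_def fun_eq_iff)
  have ind: "(LINT t|lborel. indicator {0..1} (c - t)) = (1::real)"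
    and ind_int: "integrable lborel (\<lambda>t. indicator {0..1} (c - t) :: real)" for c :: real
    by (simp_all add: shifted)
  have F_int: "integrable (lborel \<Otimes>\<^sub>M lborel) (case_prod F)"
  proof (rule lborel_pair.Fubini_integrable)
    show "integrable lborel (\<lambda>y. LINT t|lborel. norm (case_prod F (y, t)))"
      using int by (simp add: F_def abs_mult ind)
  qed (auto simp: F_def ind_int)
  \<comment> \<open>The substitution \<open>y = x + t *\<^sub>R e\<close> frees the window from
    \<open>t\<close>. The version with absolute values serves integrability.\<close>
  have F_shift: "(LINT y|lborel. F y t) = (LINT x|lborel. indicator {0..1} (x \<bullet> e) * g (x + t *\<^sub>R e))"
    "(LINT y|lborel. \<bar>F y t\<bar>) = (LINT x|lborel. \<bar>indicator {0..1} (x \<bullet> e) * g (x + t *\<^sub>R e)\<bar>)" for t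
  proof -
    have *: "F (x + t *\<^sub>R e) t = indicator {0..1} (x \<bullet> e) * g (x + t *\<^sub>R e)" for x
      by (simp add: F_def inner_add_left ee)
    show "(LINT y|lborel. F y t) = (LINT x|lborel. indicator {0..1} (x \<bullet> e) * g (x + t *\<^sub>R e))"
      by (subst lborel_integral_shift[of _ "t *\<^sub>R e", symmetric]) (simp_all add: *)
    show "(LINT y|lborel. \<bar>F y t\<bar>) = (LINT x|lborel. \<bar>indicator {0..1} (x \<bullet> e) * g (x + t *\<^sub>R e)\<bar>)"
      by (subst lborel_integral_shift[of _ "t *\<^sub>R e", symmetric]) (simp_all add: *)
  qed
  \<comment> \<open>For each \<open>t\<close> the absolute integral over \<open>x\<close> equals
    that of \<open>F\<close> over \<open>y\<close>, which is integrable in \<open>t\<close> by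
    \<open>F_int\<close>.\<close>
  have H_int: "integrable (lborel \<Otimes>\<^sub>M lborel)
      (\<lambda>(t, x). indicator {0..1} (x \<bullet> e) * g (x + t *\<^sub>R e))"
  proof (rule lborel_pair.Fubini_integrable)
    show "integrable lborel (\<lambda>t. LINT x|lborel.
        norm (case (t, x) of (t, x) \<Rightarrow> indicator {0..1} (x \<bullet> e) * g (x + t *\<^sub>R e)))"
      using lborel_pair.integrable_snd[of "\<lambda>y t. \<bar>F y t\<bar>"] F_int[THEN integrable_abs]
      by (simp add: F_shift(2) case_prod_unfold)
    show "AE t in lborel. integrable lborel
        (\<lambda>x. case (t, x) of (t, x) \<Rightarrow> indicator {0..1} (x \<bullet> e) * g (x + t *\<^sub>R e))"
    proof (rule AE_I2, unfold prod.case)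
      fix t
      have "integrable lborel (\<lambda>x. g (x + t *\<^sub>R e))" using int by (rule lborel_integrable_shift)
      then show "integrable lborel (\<lambda>x. indicator {0..1} (x \<bullet> e) * g (x + t *\<^sub>R e))"
        by (rule Bochner_Integration.integrable_bound) (auto simp: indicator_def)
    qed
  qed measurable
  have "(LINT y|lborel. g y) = (LINT y|lborel. LINT t|lborel. F y t)"
    by (simp add: F_def ind)
  also have "\<dots> = (LINT t|lborel. LINT y|lborel. F y t)"
    by (rule lborel_pair.Fubini_integral[symmetric]) (rule F_int)
  also have "\<dots> = (LINT t|lborel. LINT x|lborel. indicator {0..1} (x \<bullet> e) * g (x + t *\<^sub>R e))"
    by (simp add: F_shift)
  also have "\<dots> = (LINT x|lborel. LINT t|lborel. indicator {0..1} (x \<bullet> e) * g (x + t *\<^sub>R e))"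
    by (rule lborel_pair.Fubini_integral[symmetric]) (rule H_int)
  \<comment> \<open>The window depends on \<open>x\<close> alone and factors out of the inner
    integral.\<close>
  also have "\<dots> = 0" by (simp add: line)
  finally show ?thesis .
qed

section \<open>Rules for partial derivatives\<close>

lemma partial_eq: "(f has_derivative D) (at x) \<Longrightarrow> partial i f x = D (axis i 1)"
  unfolding partial_def by (metis frechet_derivative_at)

lemma partial_add:
  assumes "f differentiable at x" "g differentiable at x"
  shows "partial i (\<lambda>x. f x + g x) x = partial i f x + partial i g x"
  using has_derivative_add[OF assms[unfolded frechet_derivative_works]]
  by (simp add: partial_eq) (simp add: partial_def)

lemma partial_diff:
  assumes "f differentiable at x" "g differentiable at x"
  shows "partial i (\<lambda>x. f x - g x) x = partial i f x - partial i g x"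
  using has_derivative_diff[OF assms[unfolded frechet_derivative_works]]
  by (simp add: partial_eq) (simp add: partial_def)

lemma partial_mult:
  fixes f g :: "real^'n \<Rightarrow> real"
  assumes "f differentiable at x" "g differentiable at x"
  shows "partial i (\<lambda>x. f x * g x) x = partial i f x * g x + f x * partial i g x"
  using has_derivative_mult[OF assms[unfolded frechet_derivative_works]]
  by (simp add: partial_eq) (simp add: partial_def)

lemma partial_const: "partial i (\<lambda>x. c) x = 0"
  using has_derivative_const by (rule partial_eq)

lemma partial_vec_nth:
  assumes "f differentiable at x"
  shows "partial i (\<lambda>x. f x $ k) x = partial i f x $ k"
  using bounded_linear.has_derivative[OF bounded_linear_vec_nth assms[unfolded frechet_derivative_works], of k]
  by (simp add: partial_eq) (simp add: partial_def)

text \<open>Differentiation is local; this lets a field be replaced by a representative that agrees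
  with it only inside the domain.\<close>

lemma partial_cong:
  assumes "open S" "x \<in> S" "g differentiable at x" "\<And>y. y \<in> S \<Longrightarrow> f y = g y"
  shows "partial i f x = partial i g x"
proof -
  have "(f has_derivative frechet_derivative g (at x)) (at x)"
    using assms has_derivative_transform_within_open[of g _ x UNIV S f]
    by (simp add: frechet_derivative_works)
  then show ?thesis by (simp add: partial_eq) (simp add: partial_def)
qed

lemma differentiable_cong:
  assumes "open S" "x \<in> S" "g differentiable at x" "\<And>y. y \<in> S \<Longrightarrow> f y = g y"
  shows "f differentiable at x"
  using assms has_derivative_transform_within_open[of g _ x UNIV S f]
  unfolding differentiable_def by metis

lemma jacobian_nth: "jacobian f (at x) $ i $ j = partial j f x $ i"
  by (simp add: jacobian_def matrix_def partial_def)

section \<open>Functions of class C^1 up to the boundary\<close>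

lemma Ck_closure_1_iff:
  "Ck_closure 1 \<Omega> f \<longleftrightarrow> continuous_on (closure \<Omega>) f \<and> (\<forall>x\<in>\<Omega>. f differentiable at x) \<and>
    (\<forall>i. \<exists>g. continuous_on (closure \<Omega>) g \<and> (\<forall>x\<in>\<Omega>. g x = partial i f x))"
  by simp

text \<open>Chooses the continuous extensions for all directions at once, as one family
  \<open>g\<close> indexed by \<open>i\<close>.\<close>

lemma Ck_closure_1E:
  assumes "Ck_closure 1 \<Omega> f"
  obtains g where "continuous_on (closure \<Omega>) f" "\<And>x. x \<in> \<Omega> \<Longrightarrow> f differentiable at x"
    "\<And>i. continuous_on (closure \<Omega>) (g i)" "\<And>i x. x \<in> \<Omega> \<Longrightarrow> g i x = partial i f x"
  using assms unfolding Ck_closure_1_iff by metis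

lemma Ck_closure_1I:
  assumes "continuous_on (closure \<Omega>) f" "\<And>x. x \<in> \<Omega> \<Longrightarrow> f differentiable at x"
    "\<And>i. continuous_on (closure \<Omega>) (g i)" "\<And>i x. x \<in> \<Omega> \<Longrightarrow> g i x = partial i f x"
  shows "Ck_closure 1 \<Omega> f"
  using assms unfolding Ck_closure_1_iff by metis

lemma Ck_closure_1_add:
  assumes "Ck_closure 1 \<Omega> f" "Ck_closure 1 \<Omega> g"
  shows "Ck_closure 1 \<Omega> (\<lambda>x. f x + g x)"
proof -
  obtain f' g' where
    "continuous_on (closure \<Omega>) f" "\<And>x. x \<in> \<Omega> \<Longrightarrow> f differentiable at x"
    "\<And>i. continuous_on (closure \<Omega>) (f' i)" "\<And>i x. x \<in> \<Omega> \<Longrightarrow> f' i x = partial i f x"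
    "continuous_on (closure \<Omega>) g" "\<And>x. x \<in> \<Omega> \<Longrightarrow> g differentiable at x"
    "\<And>i. continuous_on (closure \<Omega>) (g' i)" "\<And>i x. x \<in> \<Omega> \<Longrightarrow> g' i x = partial i g x"
    using assms by (elim Ck_closure_1E) metis
  then show ?thesis
    by (intro Ck_closure_1I[where g = "\<lambda>i x. f' i x + g' i x"])
      (auto intro!: continuous_intros simp: partial_add)
qed

lemma Ck_closure_1_diff:
  assumes "Ck_closure 1 \<Omega> f" "Ck_closure 1 \<Omega> g"
  shows "Ck_closure 1 \<Omega> (\<lambda>x. f x - g x)"
proof -
  obtain f' g' where
    "continuous_on (closure \<Omega>) f" "\<And>x. x \<in> \<Omega> \<Longrightarrow> f differentiable at x"
    "\<And>i. continuous_on (closure \<Omega>) (f' i)" "\<And>i x. x \<in> \<Omega> \<Longrightarrow> f' i x = partial i f x"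
    "continuous_on (closure \<Omega>) g" "\<And>x. x \<in> \<Omega> \<Longrightarrow> g differentiable at x"
    "\<And>i. continuous_on (closure \<Omega>) (g' i)" "\<And>i x. x \<in> \<Omega> \<Longrightarrow> g' i x = partial i g x"
    using assms by (elim Ck_closure_1E) metis
  then show ?thesis
    by (intro Ck_closure_1I[where g = "\<lambda>i x. f' i x - g' i x"])
      (auto intro!: continuous_intros simp: partial_diff)
qed

lemma Ck_closure_1_mult:
  fixes f g :: "real^'n \<Rightarrow> real"
  assumes "Ck_closure 1 \<Omega> f" "Ck_closure 1 \<Omega> g"
  shows "Ck_closure 1 \<Omega> (\<lambda>x. f x * g x)"
proof -
  obtain f' g' where
    "continuous_on (closure \<Omega>) f" "\<And>x. x \<in> \<Omega> \<Longrightarrow> f differentiable at x"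
    "\<And>i. continuous_on (closure \<Omega>) (f' i)" "\<And>i x. x \<in> \<Omega> \<Longrightarrow> f' i x = partial i f x"
    "continuous_on (closure \<Omega>) g" "\<And>x. x \<in> \<Omega> \<Longrightarrow> g differentiable at x"
    "\<And>i. continuous_on (closure \<Omega>) (g' i)" "\<And>i x. x \<in> \<Omega> \<Longrightarrow> g' i x = partial i g x"
    using assms by (elim Ck_closure_1E) metis
  then show ?thesis
    by (intro Ck_closure_1I[where g = "\<lambda>i x. f' i x * g x + f x * g' i x"])
      (auto intro!: continuous_intros simp: partial_mult)
qed

lemma Ck_closure_1_const: "Ck_closure 1 \<Omega> (\<lambda>x. c)"
  by (rule Ck_closure_1I[where g = "\<lambda>i x. 0"]) (auto simp: partial_const)

lemma differentiable_vec_nth: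
  "f differentiable at x \<Longrightarrow> (\<lambda>x. f x $ k) differentiable at x"
  using bounded_linear.has_derivative[OF bounded_linear_vec_nth] unfolding differentiable_def by blast

lemma Ck_closure_1_vec_nth:
  assumes "Ck_closure 1 \<Omega> f"
  shows "Ck_closure 1 \<Omega> (\<lambda>x. f x $ k)"
proof -
  obtain f' where
    "continuous_on (closure \<Omega>) f" "\<And>x. x \<in> \<Omega> \<Longrightarrow> f differentiable at x"
    "\<And>i. continuous_on (closure \<Omega>) (f' i)" "\<And>i x. x \<in> \<Omega> \<Longrightarrow> f' i x = partial i f x"
    using assms by (elim Ck_closure_1E) metis
  then show ?thesis
    by (intro Ck_closure_1I[where g = "\<lambda>i x. f' i x $ k"])
      (auto intro!: continuous_intros simp: partial_vec_nth differentiable_vec_nth)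
qed

lemma Ck_closure_continuous_on: "Ck_closure k \<Omega> f \<Longrightarrow> continuous_on (closure \<Omega>) f"
  by (cases k) auto

lemma Ck_closure_Suc_imp: "Ck_closure (Suc k) \<Omega> f \<Longrightarrow> Ck_closure k \<Omega> f"
\<comment> \<open>\<open>f\<close> is generalised because the induction hypothesis is applied to the
  extended partial derivatives.\<close>
proof (induction k arbitrary: f)
  case (Suc k)
  have "\<exists>g. Ck_closure k \<Omega> g \<and> (\<forall>x\<in>\<Omega>. g x = partial i f x)" for i
  proof -
    obtain g where "Ck_closure (Suc k) \<Omega> g" "\<forall>x\<in>\<Omega>. g x = partial i f x"
      using Suc.prems by (meson Ck_closure.simps(2))
    then show ?thesis using Suc.IH by blast
  qed
  then show ?case using Suc.prems by simp
qed simp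

section \<open>The divergence theorem for functions vanishing on the boundary\<close>

lemma set_integrable_continuous_on_closure:
  fixes g :: "'a::euclidean_space \<Rightarrow> 'b::{banach, second_countable_topology}"
  assumes "open \<Omega>" "bounded \<Omega>" "continuous_on (closure \<Omega>) g"
  shows "set_integrable lborel \<Omega> g"
proof (rule set_integrable_subset)
  show "set_integrable lborel (closure \<Omega>) g"
    unfolding set_integrable_def using assms by (intro borel_integrable_compact) auto
qed (use assms closure_subset in auto)

text \<open>Transfers integrability from a continuous extension to the derivative itself, the two
  agreeing only on the domain.\<close>

lemma set_integrable_congI:
  "set_integrable M A g \<Longrightarrow> (\<And>x. x \<in> A \<Longrightarrow> f x = g x) \<Longrightarrow> set_integrable M A f"
  unfolding set_integrable_def
  by (erule back_subst[where P = "integrable M"]) (auto simp: indicator_def fun_eq_iff)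

text \<open>Every line parallel to the \<open>i\<close>-th axis cuts \<open>\<Omega>\<close> in a
  bounded open subset of the line, where the one-dimensional result applies; the vanishing line
  integrals are then combined.\<close>

lemma
  fixes f :: "real^'n \<Rightarrow> real"
  assumes \<Omega>: "open \<Omega>" "bounded \<Omega>" and f: "Ck_closure 1 \<Omega> f"
    and zero: "\<And>x. x \<in> frontier \<Omega> \<Longrightarrow> f x = 0"
  shows set_integrable_partial: "set_integrable lborel \<Omega> (partial i f)"
    and integral_partial_eq_0: "(LINT x:\<Omega>|lborel. partial i f x) = 0"
proof -
  obtain f' where f': "continuous_on (closure \<Omega>) f" "\<And>x. x \<in> \<Omega> \<Longrightarrow> f differentiable at x"
    "continuous_on (closure \<Omega>) (f' i)" "\<And>x. x \<in> \<Omega> \<Longrightarrow> f' i x = partial i f x"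
    using f by (elim Ck_closure_1E) metis
  show int: "set_integrable lborel \<Omega> (partial i f)"
    using set_integrable_continuous_on_closure[OF \<Omega> f'(3)]
    by (rule set_integrable_congI) (simp add: f'(4))
  define e :: "real^'n" where "e = axis i 1"
  have e: "norm e = 1" by (simp add: e_def)
  have "(LINT t|lborel. indicator \<Omega> (x + t *\<^sub>R e) *\<^sub>R partial i f (x + t *\<^sub>R e)) = 0" for x
  proof -
    \<comment> \<open>The slice of \<open>\<Omega>\<close> by the line through \<open>x\<close>, in
      the parameter \<open>t\<close>.\<close>
    define U where "U = (\<lambda>t. x + t *\<^sub>R e) -` \<Omega>"
    have cont: "continuous_on A (\<lambda>t. x + t *\<^sub>R e)" for A
      by (intro continuous_intros)
    have U: "open U" unfolding U_def using \<Omega>(1) cont by (rule open_vimage)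
    obtain B where B: "\<And>y. y \<in> \<Omega> \<Longrightarrow> norm y \<le> B"
      using \<Omega>(2) by (auto simp: bounded_iff)
    have "bounded U"
    proof (rule boundedI)
      fix t assume "t \<in> U"
      then have "norm (x + t *\<^sub>R e) \<le> B" using B by (simp add: U_def)
      then show "norm t \<le> B + norm x"
        using norm_triangle_ineq4[of "x + t *\<^sub>R e" x] e by simp
    qed
    have clU: "x + t *\<^sub>R e \<in> closure \<Omega>" if "t \<in> closure U" for t
    proof -
      have "closed ((\<lambda>t. x + t *\<^sub>R e) -` closure \<Omega>)"
        using cont by (intro closed_vimage) auto
      moreover have "U \<subseteq> (\<lambda>t. x + t *\<^sub>R e) -` closure \<Omega>"
        using closure_subset by (auto simp: U_def)
      ultimately show ?thesis using that closure_minimal by blast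
    qed
    have "(LINT t:U|lborel. partial i f (x + t *\<^sub>R e)) = 0"
    proof (rule integral_derivative_eq_0[OF U \<open>bounded U\<close>, where f = "\<lambda>t. f (x + t *\<^sub>R e)"])
      show "continuous_on (closure U) (\<lambda>t. f (x + t *\<^sub>R e))"
        using clU by (intro continuous_on_compose2[OF f'(1) cont]) auto
      \<comment> \<open>A frontier point of the open slice lies in its closure but not in the slice,
        so its image is in \<open>closure \<Omega>\<close> but not in
        \<open>\<Omega>\<close>.\<close>
      show "f (x + t *\<^sub>R e) = 0" if "t \<in> frontier U" for t
        using that clU U \<Omega>(1) by (intro zero) (auto simp: frontier_def interior_open U_def)
      show "((\<lambda>t. f (x + t *\<^sub>R e)) has_real_derivative partial i f (x + t *\<^sub>R e)) (at t)"
        if "t \<in> U" for t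
      proof -
        have D: "(f has_derivative frechet_derivative f (at (x + t *\<^sub>R e))) (at (x + t *\<^sub>R e))"
          using f'(2) that by (simp add: U_def frechet_derivative_works)
        have "((\<lambda>t. x + t *\<^sub>R e) has_derivative (\<lambda>h. h *\<^sub>R e)) (at t)"
          by (auto intro!: derivative_eq_intros)
        from has_derivative_compose[OF this D]
        show ?thesis
          using linear_cmul[OF has_derivative_linear[OF D]]
          by (simp add: has_field_derivative_def partial_def e_def mult.commute[of _ "frechet_derivative _ _ _"])
      qed
      show "set_integrable lborel U (\<lambda>t. partial i f (x + t *\<^sub>R e))"
      \<comment> \<open>The extension \<open>f' i\<close> is continuous up to the ends of the slice,
        while \<open>partial i f\<close> is controlled only inside.\<close>
      proof (rule set_integrable_congI)
        show "set_integrable lborel U (\<lambda>t. f' i (x + t *\<^sub>R e))"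
          using clU by (intro set_integrable_continuous_on_closure U \<open>bounded U\<close>
            continuous_on_compose2[OF f'(3) cont]) auto
      qed (use f'(4) in \<open>simp add: U_def\<close>)
    qed
    moreover have "indicator U t = (indicator \<Omega> (x + t *\<^sub>R e) :: real)" for t
      by (simp add: indicator_def U_def)
    ultimately show ?thesis by (simp add: set_lebesgue_integral_def)
  qed
  then show "(LINT x:\<Omega>|lborel. partial i f x) = 0"
    unfolding set_lebesgue_integral_def using int e
    by (intro integral_eq_0_if_line_integrals_eq_0[where e = e]) (simp_all add: set_integrable_def)
qed

text \<open>Integration by parts of a tensor field against a vector field: by the product rule
  \<open>h\<close> sums the \<open>j\<close>-th partial derivatives of the products
  \<open>T i j x * w x $ i\<close>, which vanish on the boundary together with
  \<open>w\<close>.\<close>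

lemma
  fixes T :: "'n \<Rightarrow> 'n \<Rightarrow> real^'n \<Rightarrow> real" and w :: "real^'n \<Rightarrow> real^'n"
  assumes \<Omega>: "open \<Omega>" "bounded \<Omega>" and T: "\<And>i j. Ck_closure 1 \<Omega> (T i j)"
    and w: "Ck_closure 1 \<Omega> w" and zero: "\<And>x. x \<in> frontier \<Omega> \<Longrightarrow> w x = 0"
  defines "h \<equiv> \<lambda>x. \<Sum>i\<in>UNIV. \<Sum>j\<in>UNIV. partial j (T i j) x * w x $ i + T i j x * partial j w x $ i"
  shows set_integrable_div_product: "set_integrable lborel \<Omega> h"
    and integral_div_product_eq_0: "(LINT x:\<Omega>|lborel. h x) = 0"
proof -
  define f where "f i j x = T i j x * w x $ i" for i j x
  have f: "Ck_closure 1 \<Omega> (f i j)" for i j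
    using Ck_closure_1_mult[OF T Ck_closure_1_vec_nth[OF w]] by (simp add: f_def[abs_def])
  have f0: "f i j x = 0" if "x \<in> frontier \<Omega>" for i j x
    using zero[OF that] by (simp add: f_def)
  note int = set_integrable_partial[OF \<Omega> f f0] and int0 = integral_partial_eq_0[OF \<Omega> f f0]
  have h: "h x = (\<Sum>i\<in>UNIV. \<Sum>j\<in>UNIV. partial j (f i j) x)" if "x \<in> \<Omega>" for x
    unfolding h_def f_def[abs_def] using that T[unfolded Ck_closure_1_iff] w[unfolded Ck_closure_1_iff]
    by (simp add: partial_mult partial_vec_nth differentiable_vec_nth)
  have "set_integrable lborel \<Omega> (\<lambda>x. \<Sum>i\<in>UNIV. \<Sum>j\<in>UNIV. partial j (f i j) x)"
    unfolding set_integrable_def scaleR_sum_right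
    by (intro Bochner_Integration.integrable_sum int[unfolded set_integrable_def])
  then show "set_integrable lborel \<Omega> h"
    by (rule set_integrable_congI) (rule h)
  have "(LINT x:\<Omega>|lborel. h x) = (LINT x:\<Omega>|lborel. \<Sum>i\<in>UNIV. \<Sum>j\<in>UNIV. partial j (f i j) x)"
    using h \<Omega>(1) by (intro set_lebesgue_integral_cong) auto
  also have "\<dots> = (\<Sum>i\<in>UNIV. \<Sum>j\<in>UNIV. LINT x:\<Omega>|lborel. partial j (f i j) x)"
    unfolding set_lebesgue_integral_def scaleR_sum_right
    by (simp only: Bochner_Integration.integral_sum Bochner_Integration.integrable_sum
      int[unfolded set_integrable_def])
  finally show "(LINT x:\<Omega>|lborel. h x) = 0" using int0 by simp
qed

section \<open>Symmetric gradient and tensor divergence\<close>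

lemma sym_grad_nth: "sym_grad v x $ i $ j = (partial j v x $ i + partial i v x $ j) / 2"
  by (simp add: sym_grad_def transpose_def jacobian_nth)

lemma sym_grad_add:
  assumes "v differentiable at x" "w differentiable at x"
  shows "sym_grad (\<lambda>x. v x + w x) x = sym_grad v x + sym_grad w x"
  using assms by (simp add: vec_eq_iff sym_grad_nth partial_add field_simps)

lemma vdiv_eq: "vdiv v x = (\<Sum>i\<in>UNIV. partial i v x $ i)"
  by (simp add: vdiv_def trace_def jacobian_nth)

lemma matrix_inner_eq: "(A :: real^'n^'m) \<bullet> B = (\<Sum>i\<in>UNIV. \<Sum>j\<in>UNIV. A $ i $ j * B $ i $ j)"
  by (simp add: inner_vec_def)

text \<open>Exchanging the two indices shows that a symmetric matrix pairs equally with the Jacobian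
  and with its transpose.\<close>

lemma symmetric_inner_jacobian:
  fixes S :: "real^'n^'n"
  assumes "\<And>i j. S $ i $ j = S $ j $ i"
  shows "(\<Sum>i\<in>UNIV. \<Sum>j\<in>UNIV. S $ i $ j * partial j w x $ i) = S \<bullet> sym_grad w x"
proof -
  have "(\<Sum>i\<in>UNIV. \<Sum>j\<in>UNIV. S $ i $ j * partial i w x $ j)
      = (\<Sum>j\<in>UNIV. \<Sum>i\<in>UNIV. S $ i $ j * partial i w x $ j)"
    by (rule sum.swap)
  also have "\<dots> = (\<Sum>j\<in>UNIV. \<Sum>i\<in>UNIV. S $ j $ i * partial i w x $ j)"
    by (simp add: assms)
  finally have *: "(\<Sum>i\<in>UNIV. \<Sum>j\<in>UNIV. S $ i $ j * partial i w x $ j)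
      = (\<Sum>i\<in>UNIV. \<Sum>j\<in>UNIV. S $ i $ j * partial j w x $ i)" .
  have "S \<bullet> sym_grad w x = ((\<Sum>i\<in>UNIV. \<Sum>j\<in>UNIV. S $ i $ j * partial j w x $ i)
      + (\<Sum>i\<in>UNIV. \<Sum>j\<in>UNIV. S $ i $ j * partial i w x $ j)) / 2"
    by (simp add: matrix_inner_eq sym_grad_nth sum.distrib[symmetric] sum_divide_distrib distrib_left)
  then show ?thesis by (simp add: *)
qed

text \<open>\<open>tdiv\<close> differentiates whole rows. These are differentiable at
  \<open>x\<close> because their entries agree near \<open>x\<close> with the differentiable
  \<open>R i j\<close>, so entries and derivatives may be exchanged.\<close>

lemma tdiv_nth:
  fixes R :: "'n \<Rightarrow> 'n \<Rightarrow> real^'n \<Rightarrow> real"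
  assumes "open \<Omega>" "x \<in> \<Omega>" and eq: "\<And>y i j. y \<in> \<Omega> \<Longrightarrow> A y $ i $ j = R i j y"
    and diff: "\<And>i j. R i j differentiable at x"
  shows "tdiv A x $ i = (\<Sum>j\<in>UNIV. partial j (R i j) x)"
proof -
  have r: "(\<lambda>y. row i (A y)) differentiable at x"
  proof (rule differentiable_cong[OF assms(1,2)])
    show "(\<lambda>y. \<chi> j. R i j y) differentiable at x"
      by (subst differentiable_componentwise_within) (auto simp: Basis_vec_def inner_axis diff)
  qed (simp add: row_def eq)
  have "partial j (\<lambda>y. row i (A y)) x $ j = partial j (R i j) x" for j
  proof -
    have "partial j (\<lambda>y. row i (A y)) x $ j = partial j (\<lambda>y. row i (A y) $ j) x"
      using r by (simp add: partial_vec_nth)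
    also have "\<dots> = partial j (R i j) x"
      using assms(1,2) diff by (rule partial_cong) (simp add: row_def eq)
    finally show ?thesis .
  qed
  then show ?thesis by (simp add: tdiv_def vdiv_eq)
qed

lemma Ck_closure_1_sym_grad:
  assumes "Ck_closure 1 \<Omega> z"
  obtains S where "continuous_on (closure \<Omega>) S" "\<And>x. x \<in> \<Omega> \<Longrightarrow> S x = sym_grad z x"
proof -
  obtain g where g: "\<And>i. continuous_on (closure \<Omega>) (g i)" "\<And>i x. x \<in> \<Omega> \<Longrightarrow> g i x = partial i z x"
    using assms by (elim Ck_closure_1E) metis
  show ?thesis
  proof
    show "continuous_on (closure \<Omega>) (\<lambda>x. \<chi> i j. (1/2) * (g j x $ i + g i x $ j))"
      by (intro continuous_intros g)
  qed (simp add: vec_eq_iff sym_grad_nth g)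
qed

text \<open>Supplies entries of the viscous stress that are smooth enough for integration by
  parts.\<close>

lemma Ck_closure_2_sym_grad:
  assumes "Ck_closure 2 \<Omega> v"
  obtains S where "\<And>i j. Ck_closure 1 \<Omega> (S i j)"
    "\<And>x i j. x \<in> \<Omega> \<Longrightarrow> sym_grad v x $ i $ j = S i j x"
proof -
  have "\<exists>g. Ck_closure 1 \<Omega> g \<and> (\<forall>x\<in>\<Omega>. g x = partial i v x)" for i
    using assms unfolding numeral_2_eq_2 One_nat_def by (meson Ck_closure.simps(2))
  then obtain g where g: "\<And>i. Ck_closure 1 \<Omega> (g i)" "\<And>i x. x \<in> \<Omega> \<Longrightarrow> g i x = partial i v x"
    by metis
  show ?thesis
  proof
    show "Ck_closure 1 \<Omega> (\<lambda>x. (1/2) * (g j x $ i + g i x $ j))" for i j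
      by (intro Ck_closure_1_mult Ck_closure_1_add Ck_closure_1_const Ck_closure_1_vec_nth g)
  qed (simp add: sym_grad_nth g)
qed

section \<open>Weak form and minimality of the dissipation\<close>

text \<open>Finiteness of both terms allows the two integrals in \<open>dissipation\<close> to be
  merged into one.\<close>

lemma
  assumes \<Omega>: "open \<Omega>" "bounded \<Omega>" and \<alpha>: "continuous_on (closure \<Omega>) \<alpha>" and z: "Ck_closure 1 \<Omega> z"
  shows set_integrable_drag: "set_integrable lborel \<Omega> (\<lambda>x. \<alpha> x * (z x \<bullet> z x))"
    and set_integrable_viscous: "set_integrable lborel \<Omega> (\<lambda>x. 2 * \<mu> * (sym_grad z x \<bullet> sym_grad z x))"
proof -
  show "set_integrable lborel \<Omega> (\<lambda>x. \<alpha> x * (z x \<bullet> z x))"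
    by (intro set_integrable_continuous_on_closure \<Omega> continuous_intros \<alpha> Ck_closure_continuous_on[OF z])
  obtain S where S: "continuous_on (closure \<Omega>) S" "\<And>x. x \<in> \<Omega> \<Longrightarrow> S x = sym_grad z x"
    using Ck_closure_1_sym_grad[OF z] by metis
  have "set_integrable lborel \<Omega> (\<lambda>x. 2 * \<mu> * (S x \<bullet> S x))"
    by (intro set_integrable_continuous_on_closure \<Omega> continuous_intros S)
  then show "set_integrable lborel \<Omega> (\<lambda>x. 2 * \<mu> * (sym_grad z x \<bullet> sym_grad z x))"
    by (rule set_integrable_congI) (simp add: S)
qed

text \<open>With the total stress \<open>T\<close>, the momentum equation reads
  \<open>div T = \<alpha> v\<close>. Hence \<open>c\<close> is the integrand
  \<open>div T \<bullet> w + T \<bullet> grad w\<close> of the integration by parts above, whose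
  integral is zero.\<close>

lemma darcy_brinkman_weak_form:
  fixes v w b :: "real^'n \<Rightarrow> real^'n"
  assumes \<Omega>: "open \<Omega>" "bounded \<Omega>"
    and \<psi>: "Ck_closure 1 \<Omega> \<psi>" "\<And>x. x \<in> \<Omega> \<Longrightarrow> \<rho> *\<^sub>R b x = - grad \<psi> x"
    and v: "Ck_closure 2 \<Omega> v" "darcy_brinkman_velocity \<Omega> \<alpha> \<mu> \<rho> b vp v"
    and w: "Ck_closure 1 \<Omega> w" "\<And>x. x \<in> frontier \<Omega> \<Longrightarrow> w x = 0" "\<And>x. x \<in> \<Omega> \<Longrightarrow> vdiv w x = 0"
  defines "c \<equiv> \<lambda>x. \<alpha> x * (v x \<bullet> w x) + 2 * \<mu> * (sym_grad v x \<bullet> sym_grad w x)"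
  shows "set_integrable lborel \<Omega> c" "(LINT x:\<Omega>|lborel. c x) = 0"
proof -
  obtain p where p: "Ck_closure 1 \<Omega> p"
    and momentum: "\<And>x. x \<in> \<Omega> \<Longrightarrow>
      \<alpha> x *\<^sub>R v x + grad p x - tdiv (\<lambda>y. (2 * \<mu>) *\<^sub>R sym_grad v y) x = \<rho> *\<^sub>R b x"
    using v(2) unfolding darcy_brinkman_velocity_def by blast
  obtain S where S: "\<And>i j. Ck_closure 1 \<Omega> (S i j)"
    and S_eq: "\<And>x i j. x \<in> \<Omega> \<Longrightarrow> sym_grad v x $ i $ j = S i j x"
    using Ck_closure_2_sym_grad[OF v(1)] by metis
  define R where "R i j x = 2 * \<mu> * S i j x" for i j x
  \<comment> \<open>A conservative force only modifies the pressure.\<close>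
  define q where "q x = p x + \<psi> x" for x
  define \<delta> where "\<delta> i j = (if i = j then 1 else 0 :: real)" for i j :: 'n
  \<comment> \<open>Viscous stress minus the modified pressure times the identity.\<close>
  define T where "T i j x = R i j x - \<delta> i j * q x" for i j x
  have R: "Ck_closure 1 \<Omega> (R i j)" for i j
    unfolding R_def[abs_def] by (intro Ck_closure_1_mult Ck_closure_1_const S)
  have q: "Ck_closure 1 \<Omega> q"
    unfolding q_def[abs_def] by (intro Ck_closure_1_add p \<psi>)
  have T: "Ck_closure 1 \<Omega> (T i j)" for i j
    unfolding T_def[abs_def] by (intro Ck_closure_1_diff Ck_closure_1_mult Ck_closure_1_const R q)
  have c_eq: "c x = (\<Sum>i\<in>UNIV. \<Sum>j\<in>UNIV. partial j (T i j) x * w x $ i + T i j x * partial j w x $ i)"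
    if x: "x \<in> \<Omega>" for x
  proof -
    have diff: "R i j differentiable at x" "q differentiable at x"
      "p differentiable at x" "\<psi> differentiable at x" for i j
      using R q p \<psi>(1) x by (auto simp: Ck_closure_1_iff)
    have "partial j (T i j) x = partial j (R i j) x - \<delta> i j * partial j q x" for i j
      unfolding T_def[abs_def] using diff by (simp add: partial_diff partial_mult partial_const)
    then have "(\<Sum>j\<in>UNIV. partial j (T i j) x) = (\<Sum>j\<in>UNIV. partial j (R i j) x) - partial i q x" for i
      by (simp add: sum_subtractf \<delta>_def if_distrib[of "\<lambda>a. a * _"] cong: if_cong)
    \<comment> \<open>The momentum equation, with \<open>grad p\<close> and
      \<open>grad \<psi>\<close> collected in the derivative of \<open>q\<close>.\<close>
    also have "\<dots> i = \<alpha> x * v x $ i" for i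
    proof -
      have "tdiv (\<lambda>y. (2 * \<mu>) *\<^sub>R sym_grad v y) x $ i = (\<Sum>j\<in>UNIV. partial j (R i j) x)"
        using \<Omega>(1) x by (rule tdiv_nth[OF _ _ _ diff(1)]) (simp add: R_def S_eq)
      moreover have "partial i q x = partial i p x + partial i \<psi> x"
        unfolding q_def[abs_def] using diff by (simp add: partial_add)
      moreover have "(\<alpha> x *\<^sub>R v x + grad p x - tdiv (\<lambda>y. (2 * \<mu>) *\<^sub>R sym_grad v y) x) $ i
          = (- grad \<psi> x) $ i"
        using momentum[OF x] \<psi>(2)[OF x] by simp
      ultimately show ?thesis by (simp add: grad_def)
    qed
    finally have divT: "(\<Sum>j\<in>UNIV. partial j (T i j) x) = \<alpha> x * v x $ i" for i .
    have "(\<Sum>i\<in>UNIV. \<Sum>j\<in>UNIV. T i j x * partial j w x $ i)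
        = 2 * \<mu> * (\<Sum>i\<in>UNIV. \<Sum>j\<in>UNIV. sym_grad v x $ i $ j * partial j w x $ i)
          - q x * (\<Sum>i\<in>UNIV. partial i w x $ i)"
      using x by (simp add: T_def R_def S_eq left_diff_distrib sum_subtractf sum_distrib_left \<delta>_def
        if_distrib[of "\<lambda>a. a * _"] mult.assoc cong: if_cong)
    \<comment> \<open>The pressure term carries the divergence of \<open>w\<close>, which is zero;
      symmetry of the viscous stress replaces the Jacobian of \<open>w\<close> by its symmetric
      part.\<close>
    also have "\<dots> = 2 * \<mu> * (sym_grad v x \<bullet> sym_grad w x)"
    proof -
      have "sym_grad v x $ i $ j = sym_grad v x $ j $ i" for i j
        by (simp add: sym_grad_nth)
      then show ?thesis
        using w(3)[OF x] by (simp add: symmetric_inner_jacobian vdiv_eq)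
    qed
    finally show ?thesis
      by (simp add: c_def sum.distrib sum_distrib_right[symmetric] divT)
        (simp add: inner_vec_def sum_distrib_left mult.assoc)
  qed
  show "set_integrable lborel \<Omega> c"
    using set_integrable_div_product[where T = T, OF \<Omega> T w(1,2)] by (rule set_integrable_congI) (simp_all add: c_eq)
  have "(LINT x:\<Omega>|lborel. c x) = (LINT x:\<Omega>|lborel. \<Sum>i\<in>UNIV. \<Sum>j\<in>UNIV.
      partial j (T i j) x * w x $ i + T i j x * partial j w x $ i)"
    using c_eq \<Omega>(1) by (intro set_lebesgue_integral_cong) auto
  then show "(LINT x:\<Omega>|lborel. c x) = 0"
    using integral_div_product_eq_0[where T = T, OF \<Omega> T w(1,2)] by simp
qed

theorem theorem2:
  fixes \<Omega> :: "(real^'n) set"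
    and \<alpha> \<psi> :: "real^'n \<Rightarrow> real"
    and \<mu> \<rho> :: real
    and b vp v vt :: "real^'n \<Rightarrow> real^'n"
  assumes "open \<Omega>" and "bounded \<Omega>" and "piecewise_smooth_boundary \<Omega>"
    and "Ck_closure 0 \<Omega> \<alpha>" and "\<forall>x\<in>\<Omega>. \<alpha> x > 0"
    and "\<mu> > 0"
    and "Ck_closure 1 \<Omega> \<psi>" and "\<forall>x\<in>\<Omega>. \<rho> *\<^sub>R b x = - grad \<psi> x"
    and "Ck_closure 2 \<Omega> v" and "darcy_brinkman_velocity \<Omega> \<alpha> \<mu> \<rho> b vp v"
    and "Ck_closure 1 \<Omega> vt" and "kinematically_admissible \<Omega> vp vt"
  shows "dissipation \<Omega> \<alpha> \<mu> v \<le> dissipation \<Omega> \<alpha> \<mu> vt"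
proof -
  note \<Omega> = assms(1,2)
  have \<alpha>: "continuous_on (closure \<Omega>) \<alpha>" using assms(4) by simp
  have v: "Ck_closure 1 \<Omega> v"
    using Ck_closure_Suc_imp[of 1 \<Omega> v] assms(9) by (simp add: numeral_2_eq_2)
  define w where "w x = vt x - v x" for x
  \<comment> \<open>Half the cross term in the expansion of the dissipation density \<open>d\<close>
    at \<open>v + w\<close>.\<close>
  define c where "c x = \<alpha> x * (v x \<bullet> w x) + 2 * \<mu> * (sym_grad v x \<bullet> sym_grad w x)" for x
  define d where "d z x = \<alpha> x * (z x \<bullet> z x) + 2 * \<mu> * (sym_grad z x \<bullet> sym_grad z x)" for z x
  have w: "Ck_closure 1 \<Omega> w"
    unfolding w_def[abs_def] by (intro Ck_closure_1_diff v assms)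
  have diff: "v differentiable at x" "vt differentiable at x" "w differentiable at x" if "x \<in> \<Omega>" for x
    using v w assms(11) that by (auto simp: Ck_closure_1_iff)
  have w_zero: "w x = 0" if "x \<in> frontier \<Omega>" for x
    using assms(10,12) that by (auto simp: w_def darcy_brinkman_velocity_def kinematically_admissible_def)
  have w_div: "vdiv w x = 0" if "x \<in> \<Omega>" for x
  proof -
    have "vdiv w x = vdiv vt x - vdiv v x"
      unfolding w_def[abs_def] vdiv_eq using diff[OF that] by (simp add: partial_diff sum_subtractf)
    then show ?thesis
      using assms(10,12) that by (auto simp: darcy_brinkman_velocity_def kinematically_admissible_def)
  qed
  have c: "set_integrable lborel \<Omega> c" "(LINT x:\<Omega>|lborel. c x) = 0"
    using darcy_brinkman_weak_form[OF \<Omega> assms(7) _ assms(9,10) w w_zero w_div] assms(8)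
    by (simp_all add: c_def[abs_def])
  have d_int: "set_integrable lborel \<Omega> (d z)"
    and d_eq: "dissipation \<Omega> \<alpha> \<mu> z = (LINT x:\<Omega>|lborel. d z x)" if "Ck_closure 1 \<Omega> z" for z
    using set_integrable_drag[OF \<Omega> \<alpha> that] set_integrable_viscous[OF \<Omega> \<alpha> that, of \<mu>]
    by (simp_all add: d_def[abs_def] dissipation_def set_integral_add)
  \<comment> \<open>Adding \<open>2 * c x\<close>, whose integral is zero, makes the two integrands
    comparable pointwise: they differ by \<open>d w x\<close>.\<close>
  have "dissipation \<Omega> \<alpha> \<mu> v = (LINT x:\<Omega>|lborel. d v x + 2 * c x)"
    using c d_int[OF v] d_eq[OF v] by (simp add: set_integral_add)
  also have "\<dots> \<le> (LINT x:\<Omega>|lborel. d vt x)"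
  proof (rule set_integral_mono)
    fix x assume x: "x \<in> \<Omega>"
    have vt: "vt = (\<lambda>x. v x + w x)" by (simp add: w_def)
    have "sym_grad vt x = sym_grad v x + sym_grad w x"
      unfolding vt using diff[OF x] by (simp add: sym_grad_add)
    then have "d vt x = d v x + 2 * c x + d w x"
      by (simp add: d_def c_def vt inner_add_left inner_add_right inner_commute algebra_simps)
    moreover have "d w x \<ge> 0"
      using assms(5,6) x by (simp add: d_def less_imp_le)
    ultimately show "d v x + 2 * c x \<le> d vt x" by simp
  qed (use c d_int[OF v] d_int[OF assms(11)] in auto)
  also have "\<dots> = dissipation \<Omega> \<alpha> \<mu> vt"
    by (rule d_eq[symmetric]) (rule assms(11))
  finally show ?thesis .
qed

end
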